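(* Let $\Gamma$ be a simple connected graph. Suppose $\Gamma$ has two distinct vertices $u,w$ such that $u$ is adjacent to $w$ and $\operatorname{nbd}(u)\cap\operatorname{nbd}(w)=\emptyset$. Then there exists a non-zero $(0,1)$-vector in the row space of the adjacency matrix $A(\Gamma)$ over $\mathbb{R}$ which does not occur as a row of $A(\Gamma)$.
   Context: $\operatorname{nbd}(x)$ denotes the set of vertices adjacent to $x$. The adjacency matrix $A(\Gamma)=(a_{ij})$ has $a_{ij}=1$ if $v_i$ is adjacent to $v_j$ and $0$ otherwise; the row space is over the real numbers. *)

theory Defs
  imports
    "Graph_Theory.Graph_Theory"
    "Jordan_Normal_Form.VS_Connect"
begin

text \<open>
  A finite simple graph is a symmetric loop-free digraph without parallel arcs (locale \<open>graph\<close>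
  of the entry Graph_Theory), so that \<open>x \<rightarrow>\<^bsub>G\<^esub> y\<close> is the adjacency relation.
\<close>

definition nbd :: "('a, 'b) pre_digraph \<Rightarrow> 'a \<Rightarrow> 'a set" where
  "nbd G x = {y \<in> verts G. x \<rightarrow>\<^bsub>G\<^esub> y}"

text \<open>The list \<open>vs\<close> is the enumeration of the vertices that indexes the rows and columns.\<close>

definition adjacency_matrix :: "('a, 'b) pre_digraph \<Rightarrow> 'a list \<Rightarrow> real mat" where
  "adjacency_matrix G vs =
     mat (length vs) (length vs) (\<lambda>(i, j). if vs ! i \<rightarrow>\<^bsub>G\<^esub> vs ! j then 1 else 0)"

definition zero_one_vec :: "'c :: zero_neq_one vec \<Rightarrow> bool" where
  "zero_one_vec x \<longleftrightarrow> (\<forall>i < dim_vec x. x $ i \<in> {0, 1})"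

end

theory Submission
  imports Defs
begin

text \<open>
  The sum of the rows of \<open>u\<close> and \<open>w\<close> is the indicator vector of the disjoint union of \<open>nbd u\<close>
  and \<open>nbd w\<close>. Since \<open>u\<close> and \<open>w\<close> are adjacent, it has a 1 at both \<open>u\<close> and \<open>w\<close>, so a vertex
  with this row would be a common neighbour of \<open>u\<close> and \<open>w\<close>.
\<close>

theorem theorem4p3:
  fixes G :: "('a, 'b) pre_digraph" and vs :: "'a list" and u w :: 'a
  assumes "graph G"
    and "Digraph_Component.connected G"
    and "distinct vs" and "set vs = verts G"
    and "u \<in> verts G" and "w \<in> verts G" and "u \<noteq> w"
    and "u \<rightarrow>\<^bsub>G\<^esub> w"
    and "nbd G u \<inter> nbd G w = {}"
  shows "\<exists>x \<in> vec_space.row_space (length vs) (adjacency_matrix G vs).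
           zero_one_vec x \<and> x \<noteq> 0\<^sub>v (length vs) \<and>
           x \<notin> set (rows (adjacency_matrix G vs))"
proof -
  interpret graph G by (rule assms(1))
  define n where "n = length vs"
  interpret V: vec_space "TYPE(real)" n .
  define A where "A = adjacency_matrix G vs"
  have dim: "dim_row A = n" "dim_col A = n"
    by (simp_all add: A_def adjacency_matrix_def n_def)
  have ent: "row A i $ j = (if vs ! i \<rightarrow>\<^bsub>G\<^esub> vs ! j then 1 else 0)" if "i < n" "j < n" for i j
    using that by (simp add: A_def adjacency_matrix_def n_def)
  have wu: "w \<rightarrow>\<^bsub>G\<^esub> u"
    using \<open>u \<rightarrow>\<^bsub>G\<^esub> w\<close> by (rule arcs_ends_symmetric[OF sym_arcs])
  from assms(4,5,6) obtain a b where a: "a < n" "vs ! a = u" and b: "b < n" "vs ! b = w"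
    by (metis in_set_conv_nth n_def)
  define x where "x = row A a + row A b"
  have x_index: "x $ j = (if u \<rightarrow>\<^bsub>G\<^esub> vs ! j then 1 else 0) + (if w \<rightarrow>\<^bsub>G\<^esub> vs ! j then 1 else 0)"
    if "j < n" for j
    \<comment> \<open>\<open>index_row(1)\<close> would rewrite a row entry into a matrix entry
      before \<open>ent\<close> could match it.\<close>
    using that a b by (simp add: x_def ent dim del: index_row(1))
  \<comment> \<open>No condition \<open>z \<in> verts G\<close> is needed here: an arc into
    \<open>z\<close> already makes \<open>z\<close> a vertex.\<close>
  have no_common: "\<not> (u \<rightarrow>\<^bsub>G\<^esub> z \<and> w \<rightarrow>\<^bsub>G\<^esub> z)" for z
    using assms(9) by (auto simp: nbd_def dest: adj_in_verts)
  have dim_x: "dim_vec x = n"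
    by (simp add: x_def dim)
  have rows_carrier: "set (rows A) \<subseteq> carrier_vec n"
    using rows_carrier[of A] dim by simp
  have row_in_span: "row A i \<in> V.span (set (rows A))" if "i < n" for i
    using V.span_mem[OF rows_carrier] that dim by (simp add: rows_def)
  \<comment> \<open>At \<open>a\<close> the arc from \<open>w\<close> to \<open>u\<close>
    contributes 1, and \<open>no_common\<close> at \<open>u\<close> then excludes a loop at
    \<open>u\<close>, so the other summand is 0. The entry at \<open>b\<close> is symmetric.\<close>
  have xa: "x $ a = 1" and xb: "x $ b = 1"
    using x_index[OF a(1)] x_index[OF b(1)] wu \<open>u \<rightarrow>\<^bsub>G\<^esub> w\<close> no_common[of u] no_common[of w]
    unfolding a(2) b(2) by simp_all
  have "x \<in> V.row_space A"
    unfolding V.row_space_def x_def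
    using V.span_add1[OF _ row_in_span[OF a(1)] row_in_span[OF b(1)]] rows_carrier by simp
  \<comment> \<open>Each entry is a sum of two indicators; the value 2 would require a common
    neighbour.\<close>
  moreover have "zero_one_vec x"
    using no_common by (simp add: zero_one_vec_def dim_x x_index)
  moreover have "x \<noteq> 0\<^sub>v n"
    using xa a by auto
  moreover have "x \<notin> set (rows A)"
  proof
    assume "x \<in> set (rows A)"
    then obtain i where i: "i < n" "x = row A i"
      by (auto simp: rows_def dim)
    have "vs ! i \<rightarrow>\<^bsub>G\<^esub> u" "vs ! i \<rightarrow>\<^bsub>G\<^esub> w"
      using xa xb ent[OF i(1) a(1)] ent[OF i(1) b(1)] unfolding i(2) a(2) b(2)
      by (simp_all split: if_splits)
    \<comment> \<open>The arcs found start at \<open>vs ! i\<close>, while \<open>no_common\<close>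
      concerns arcs out of \<open>u\<close> and \<open>w\<close>; symmetry reverses them.\<close>
    then show False
      using no_common[of "vs ! i"] arcs_ends_symmetric[OF sym_arcs] by simp
  qed
  ultimately show ?thesis
    unfolding A_def n_def by blast
qed

end
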